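(* Let $n\ge1$ be an integer, let $A=(a_{ij})\in\mathbb{R}^{n\times n}$, and let $1=c_1<c_2<\cdots<c_d=n$ be the divisors of $n$. For $k=1,\dots,n-1$ let $$H_k(\mathbf{x})=\sum_{i=0}^{n-1}\sum_{j=2}^{d}\alpha_{ijk}\,x_{ij}\in\mathbb{Z}[\mathbf{x}],$$ where $$\alpha_{ijk}=\begin{cases}-n+\frac{n}{c_j},&\text{if } i=k\text{ and }k\equiv0\pmod{\frac{n}{c_j}},\\ -n,&\text{if } i=k\text{ and }k\not\equiv0\pmod{\frac{n}{c_j}},\\ \frac{n}{c_j},&\text{if } i\ne k\text{ and }k\equiv0\pmod{\frac{n}{c_j}},\\ 0,&\text{if } i\neq k\text{ and }k\not\equiv0\pmod{\frac{n}{c_j}}.\end{cases}$$ Then $A$ is a CSP-matrix if and only if $A=(\mathbf{a}_1|\mathbf{a}_2|\cdots|\mathbf{a}_n)$ with columns $$\mathbf{a}_1=(x_{01},H_1(\mathbf{x}),\dots,H_{n-1}(\mathbf{x}))^t,$$ $$\mathbf{a}_{c_j}=(nx_{0j},nx_{1j},\dots,nx_{(n-1)j})^t\quad\text{for }j=2,\dots,d,$$ $$\mathbf{a}_c=\mathbf{0}\quad\text{for }c\in\{2,\dots,n\},\ c\nmid n,$$ for some real numbers $x_{01}$ and $x_{ij}$ ($0\le i\le n-1$, $2\le j\le d$) satisfying $x_{01}\ge0$, $x_{ij}\ge0$ for all $i,j$, and $H_k(\mathbf{x})\ge0$ for all $k=1,\dots,n-1$.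
   Context: Rows of $n\times n$ matrices are indexed by $i=0,\dots,n-1$ and columns by $j=1,\dots,n$. Let $\omega_n$ be a primitive $n$-th root of unity. A matrix $A=(a_{ij})\in\mathbb{R}_{\ge 0}^{n\times n}$ (all entries non-negative) is a CSP-matrix if for each $1\le k\le n$, $$\sum_{\substack{0\le i<n\\1\le j\le n}}a_{ij}\,\omega_n^{ki}=\sum_{0\le i<n}\ \sum_{j\mid k}a_{ij}.$$ *)

theory Defs
  imports
    Complex_Main
    "HOL-Number_Theory.Cong"
    "Jordan_Normal_Form.Matrix"
begin

definition primitive_root_of_unity :: "nat \<Rightarrow> complex \<Rightarrow> bool" where
  "primitive_root_of_unity n w \<longleftrightarrow> w ^ n = 1 \<and> (\<forall>m. 0 < m \<and> m < n \<longrightarrow> w ^ m \<noteq> 1)"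

text \<open>
  Rows are indexed by \<open>0, \<dots>, n - 1\<close> and columns by \<open>1, \<dots>, n\<close>, whereas the columns of a
  library matrix are indexed from 0. So the entry in row \<open>i\<close> and column \<open>j\<close> is
  \<open>A $$ (i, j - 1)\<close>, and the \<open>j\<close>-th column is \<open>col A (j - 1)\<close>.
\<close>

definition csp_matrix :: "nat \<Rightarrow> complex \<Rightarrow> real mat \<Rightarrow> bool" where
  "csp_matrix n w A \<longleftrightarrow>
     A \<in> carrier_mat n n \<and>
     (\<forall>i\<in>{0..<n}. \<forall>j\<in>{1..n}. 0 \<le> A $$ (i, j - 1)) \<and>
     (\<forall>k\<in>{1..n}.
        (\<Sum>i=0..<n. \<Sum>j=1..n. complex_of_real (A $$ (i, j - 1)) * w ^ (k * i)) =
        complex_of_real (\<Sum>i=0..<n. \<Sum>j\<in>{j\<in>{1..n}. j dvd k}. A $$ (i, j - 1)))"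

text \<open>
  In the following, \<open>c 1 < \<dots> < c d\<close> enumerates the divisors of \<open>n\<close>, so \<open>n div c j\<close> is exact.
\<close>

definition H_coeff :: "nat \<Rightarrow> (nat \<Rightarrow> nat) \<Rightarrow> nat \<Rightarrow> nat \<Rightarrow> nat \<Rightarrow> int" where
  "H_coeff n c i j k =
     (if i = k \<and> [k = 0] (mod (n div c j)) then - int n + int (n div c j)
      else if i = k \<and> \<not> [k = 0] (mod (n div c j)) then - int n
      else if i \<noteq> k \<and> [k = 0] (mod (n div c j)) then int (n div c j)
      else 0)"

text \<open>The value of the integer linear form \<open>H\<^sub>k\<close> at the real point \<open>x\<close>.\<close>

definition H_form :: "nat \<Rightarrow> nat \<Rightarrow> (nat \<Rightarrow> nat) \<Rightarrow> nat \<Rightarrow> (nat \<Rightarrow> nat \<Rightarrow> real) \<Rightarrow> real" where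
  "H_form n d c k x = (\<Sum>i=0..n-1. \<Sum>j=2..d. of_int (H_coeff n c i j k) * x i j)"

end

theory Submission
  imports Defs
begin

text \<open>
  Write \<open>R\<^sub>i\<close> for the row sums and \<open>C\<^sub>j\<close> for the column sums of \<open>A\<close>. The condition for \<open>k = n\<close>
  compares the total of all entries with the total over the columns whose number divides \<open>n\<close>, so
  non-negativity forces the other columns to vanish. What remains says that the discrete Fourier
  transform of \<open>R\<close> takes at \<open>k\<close> the value \<open>\<Sum>j | gcd n k. C\<^sub>j\<close>.

  This right-hand side is itself a transform: the indicator of the multiples of \<open>n/j\<close>, scaled by
  \<open>1/j\<close>, is transformed into the indicator of the multiples of \<open>j\<close> (\<open>transform_comb\<close>). Because the
  transform is injective (\<open>transform_eq_0_imp_eq_0\<close>), the condition is equivalent to the real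
  linear equations \<open>R\<^sub>i = (\<Sum>j | n. [n/j divides i] C\<^sub>j / j)\<close> for \<open>i = 0, \<dots>, n - 1\<close>.

  Both sides of these equations have the same total over \<open>i\<close>, so the equation for \<open>i = 0\<close> follows from
  the others (\<open>csp_condition_iff_row_sums\<close>). In the equation for \<open>i = k > 0\<close> the column \<open>j = 1\<close> does not contribute on the right, and on
  the left it contributes the single entry \<open>a\<^bsub>k1\<^esub>\<close>. Solving for this entry, with the entries in
  the columns \<open>c\<^sub>j\<close>, \<open>j \<ge> 2\<close>, written as \<open>n x\<^bsub>ij\<^esub>\<close>, gives \<open>a\<^bsub>k1\<^esub> = H\<^sub>k(x)\<close>
  (\<open>H_form_eq_row_defect\<close>). The entry \<open>a\<^bsub>01\<^esub>\<close> stays free.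
\<close>

section \<open>Roots of unity and the discrete Fourier transform\<close>

lemma primitive_root_power_eq_1_iff:
  assumes "n \<ge> 1" and "primitive_root_of_unity n w"
  shows "w ^ m = 1 \<longleftrightarrow> n dvd m"
proof -
  have "w ^ m = w ^ (n * (m div n) + m mod n)"
    by simp
  also have "\<dots> = w ^ (m mod n)"
    using assms(2) by (simp only: power_add power_mult primitive_root_of_unity_def) simp
  finally have "w ^ m = w ^ (m mod n)" .
  moreover have "m mod n < n"
    using assms(1) by simp
  ultimately show ?thesis
    using assms(2) unfolding primitive_root_of_unity_def
    by (metis dvd_eq_mod_eq_0 gr0I power_0)
qed

lemma sum_powers_root_of_unity:
  fixes z :: complex
  assumes "z ^ n = 1"
  shows "(\<Sum>i<n. z ^ i) = (if z = 1 then of_nat n else 0)"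
  using assms by (simp add: geometric_sum)

lemma sum_powers_root_of_unity_from_1:
  fixes z :: complex
  assumes "z ^ n = 1"
  shows "(\<Sum>k=1..n. z ^ k) = (if z = 1 then of_nat n else 0)"
proof -
  have "(\<Sum>k=1..n. z ^ k) = z * (\<Sum>i<n. z ^ i)"
    by (simp add: sum.atLeast1_atMost_eq sum_distrib_left)
  then show ?thesis
    by (simp add: sum_powers_root_of_unity[OF assms])
qed

text \<open>
  The value at \<open>m\<close> is recovered by pairing the transform with the inverse character
  \<open>k \<mapsto> w\<^bsup>- k m\<^esup>\<close>, written with the non-negative exponent \<open>n - m\<close>.
\<close>

lemma transform_eq_0_imp_eq_0:
  fixes f :: "nat \<Rightarrow> complex"
  assumes n: "n \<ge> 1" and w: "primitive_root_of_unity n w"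
    and zero: "\<And>k. k \<in> {1..n} \<Longrightarrow> (\<Sum>i<n. f i * w ^ (k * i)) = 0"
    and m: "m < n"
  shows "f m = 0"
proof -
  have orth: "(\<Sum>k=1..n. w ^ (k * (n - m + i))) = (if i = m then of_nat n else 0)"
    if i: "i < n" for i
  proof -
    let ?z = "w ^ (n - m + i)"
    have "?z ^ n = 1"
      using primitive_root_power_eq_1_iff[OF n w, of "(n - m + i) * n"] by (simp add: power_mult)
    then have "(\<Sum>k=1..n. ?z ^ k) = (if ?z = 1 then of_nat n else 0)"
      by (rule sum_powers_root_of_unity_from_1)
    moreover have "?z = 1 \<longleftrightarrow> i = m"
    proof -
      have "n dvd n - m + i \<longleftrightarrow> i = m"
      proof
        assume "n dvd n - m + i"
        then obtain q where q: "n - m + i = n * q" ..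
        \<comment> \<open>The exponent lies strictly between \<open>0\<close> and \<open>2n\<close>, so it can only be \<open>n\<close>.\<close>
        have "n * q < n * 2" and "n * 0 < n * q"
          using q i m by linarith+
        then have "q = 1"
          by (simp only: mult_less_cancel1) simp
        with q m show "i = m"
          by simp
      qed (use m in simp)
      then show ?thesis
        using primitive_root_power_eq_1_iff[OF n w] by simp
    qed
    ultimately show ?thesis
      by (simp add: power_mult mult.commute[of _ "n - m + i"])
  qed
  have "0 = (\<Sum>k=1..n. w ^ (k * (n - m)) * (\<Sum>i<n. f i * w ^ (k * i)))"
    using zero by simp
  also have "\<dots> = (\<Sum>i<n. \<Sum>k=1..n. f i * w ^ (k * (n - m + i)))"
    by (subst sum.swap) (simp add: sum_distrib_left power_add distrib_left mult_ac)
  also have "\<dots> = (\<Sum>i<n. f i * (if i = m then of_nat n else 0))"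
    by (intro sum.cong refl) (simp only: orth lessThan_iff flip: sum_distrib_left)
  also have "\<dots> = f m * of_nat n"
    using m by (simp add: if_distrib[of "(*) _"] cong: if_cong)
  finally show ?thesis
    using n by simp
qed

text \<open>
  The multiples of \<open>n/j\<close> below \<open>n\<close> are \<open>l n/j\<close> with \<open>l < j\<close>, so the transform is a geometric
  sum of length \<open>j\<close> in the \<open>j\<close>-th root of unity \<open>w\<^bsup>k n/j\<^esup>\<close>.
\<close>

lemma transform_comb:
  assumes n: "n \<ge> 1" and w: "primitive_root_of_unity n w" and j: "j dvd n"
  shows "(\<Sum>i<n. if n div j dvd i then w ^ (k * i) else 0) = (if j dvd k then of_nat j else 0)"
proof -
  obtain q where q: "n = j * q"
    using j ..
  have pos: "j > 0" "q > 0"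
    using q n by (auto intro: Nat.gr0I)
  have "(\<Sum>i<n. if n div j dvd i then w ^ (k * i) else 0) = (\<Sum>i | i < n \<and> q dvd i. w ^ (k * i))"
    using q pos by (simp add: sum.If_cases Int_def)
  also have "\<dots> = (\<Sum>l<j. w ^ (k * (q * l)))"
    by (rule sum.reindex_bij_witness[of _ "\<lambda>l. q * l" "\<lambda>i. i div q"])
       (use q pos in \<open>auto simp: less_mult_imp_div_less mult.commute\<close>)
  also have "\<dots> = (\<Sum>l<j. (w ^ (k * q)) ^ l)"
    by (simp add: mult.assoc flip: power_mult)
  also have "\<dots> = (if w ^ (k * q) = 1 then of_nat j else 0)"
  proof (rule sum_powers_root_of_unity)
    show "(w ^ (k * q)) ^ j = 1"
      using primitive_root_power_eq_1_iff[OF n w, of "k * q * j"] q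
      by (simp add: mult_ac flip: power_mult)
  qed
  also have "w ^ (k * q) = 1 \<longleftrightarrow> j dvd k"
    using primitive_root_power_eq_1_iff[OF n w, of "k * q"] q pos by simp
  finally show ?thesis .
qed

lemma transform_comb_combination:
  fixes s :: "nat \<Rightarrow> real"
  assumes n: "n \<ge> 1" and w: "primitive_root_of_unity n w"
  shows "(\<Sum>i<n. complex_of_real (\<Sum>j | j dvd n. if n div j dvd i then s j / j else 0) * w ^ (k * i))
       = complex_of_real (\<Sum>j | j dvd n \<and> j dvd k. s j)"
proof -
  have fin: "finite {j. j dvd n}"
    using n by simp
  have "(\<Sum>i<n. complex_of_real (\<Sum>j | j dvd n. if n div j dvd i then s j / j else 0) * w ^ (k * i))
      = (\<Sum>i<n. \<Sum>j | j dvd n.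
          complex_of_real (s j / j) * (if n div j dvd i then w ^ (k * i) else 0))"
    by (auto simp: sum_distrib_right intro!: sum.cong)
  also have "\<dots> = (\<Sum>j | j dvd n. complex_of_real (s j / j) * (if j dvd k then of_nat j else 0))"
    by (subst sum.swap) (simp add: transform_comb[OF n w] del: times_divide_eq_left of_real_divide
        flip: sum_distrib_left)
  also have "\<dots> = (\<Sum>j | j dvd n. if j dvd k then complex_of_real (s j) else 0)"
    using n by (intro sum.cong) auto
  also have "\<dots> = complex_of_real (\<Sum>j | j dvd n \<and> j dvd k. s j)"
    using fin by (simp add: sum.If_cases Int_def)
  finally show ?thesis .
qed

section \<open>The condition as a system of real linear equations\<close>

text \<open>
  If the columns with non-dividing number vanish, then the row sums and the combination of combs
  on the right have the same total, namely the total of all entries. This is why the equation for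
  row \<open>0\<close> may be left out.
\<close>

lemma csp_condition_iff_row_sums:
  fixes a :: "nat \<Rightarrow> nat \<Rightarrow> real"
  assumes n: "n \<ge> 1" and w: "primitive_root_of_unity n w"
    and nonneg: "\<And>i j. i < n \<Longrightarrow> j \<in> {1..n} \<Longrightarrow> 0 \<le> a i j"
  shows "(\<forall>k\<in>{1..n}. (\<Sum>i<n. \<Sum>j=1..n. complex_of_real (a i j) * w ^ (k * i)) =
                     complex_of_real (\<Sum>i<n. \<Sum>j | j \<in> {1..n} \<and> j dvd k. a i j))
     \<longleftrightarrow> (\<forall>j\<in>{1..n}. \<not> j dvd n \<longrightarrow> (\<forall>i<n. a i j = 0)) \<and>
         (\<forall>k\<in>{1..<n}. (\<Sum>j | j dvd n. a k j) =
             (\<Sum>j | j dvd n. if n div j dvd k then (\<Sum>i<n. a i j) / j else 0))"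
    (is "?csp \<longleftrightarrow> ?cols \<and> ?rows")
proof -
  define R where "R k = (\<Sum>j | j dvd n. a k j)" for k
  define C where "C j = (\<Sum>i<n. a i j)" for j
  define T where "T k = (\<Sum>j | j dvd n. if n div j dvd k then C j / j else 0)" for k
  have sub: "{j. j dvd n} \<subseteq> {1..n}"
    using n by (auto dest: dvd_imp_le intro: Suc_leI Nat.gr0I)
  have T_transform:
    "(\<Sum>i<n. complex_of_real (T i) * w ^ (k * i)) = complex_of_real (\<Sum>j | j dvd n \<and> j dvd k. C j)"
    for k
    unfolding T_def by (rule transform_comb_combination[OF n w])
  have "complex_of_real (\<Sum>i<n. T i) = complex_of_real (\<Sum>j | j dvd n. C j)"
    using T_transform[of 0] by simp
  then have T_total: "(\<Sum>i<n. T i) = (\<Sum>j | j dvd n. C j)"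
    by (simp only: of_real_eq_iff)
  have R_total: "(\<Sum>i<n. R i) = (\<Sum>j | j dvd n. C j)"
    unfolding R_def C_def by (rule sum.swap)
  have cols: ?cols if ?csp
  proof -
    let ?N = "{1..n} - {j. j dvd n}"
    have "w ^ (n * i) = 1" for i
      using primitive_root_power_eq_1_iff[OF n w] by simp
    then have "complex_of_real (\<Sum>i<n. \<Sum>j=1..n. a i j) =
        complex_of_real (\<Sum>i<n. \<Sum>j | j \<in> {1..n} \<and> j dvd n. a i j)"
      using bspec[OF that, of n] n by simp
    then have "(\<Sum>i<n. \<Sum>j=1..n. a i j) = (\<Sum>i<n. \<Sum>j | j \<in> {1..n} \<and> j dvd n. a i j)"
      by (simp only: of_real_eq_iff)
    also have "{j. j \<in> {1..n} \<and> j dvd n} = {j. j dvd n}"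
      using sub by auto
    finally have "(\<Sum>i<n. \<Sum>j\<in>?N. a i j) = 0"
      by (simp only: sum_diff[OF finite_atLeastAtMost sub] sum_subtractf)
    moreover have "0 \<le> (\<Sum>j\<in>?N. a i j)" if "i < n" for i
      using nonneg that by (auto intro: sum_nonneg)
    ultimately have row_0: "(\<Sum>j\<in>?N. a i j) = 0" if "i < n" for i
      using that by (subst (asm) sum_nonneg_eq_0_iff) auto
    have "a i j = 0" if "i < n" "j \<in> ?N" for i j
      by (rule sum_nonneg_0[OF _ _ row_0[OF that(1)] that(2)]) (use that nonneg in auto)
    then show ?thesis
      by auto
  qed
  have csp_iff: "?csp \<longleftrightarrow> (\<forall>k<n. R k = T k)" if ?cols
  proof -
    have row: "(\<Sum>j=1..n. complex_of_real (a i j) * z) = complex_of_real (R i) * z"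
      if "i < n" for i and z :: complex
    proof -
      have "(\<Sum>j=1..n. a i j) = R i"
        unfolding R_def using sub \<open>?cols\<close> that by (intro sum.mono_neutral_right) auto
      then show ?thesis
        by (simp flip: sum_distrib_right of_real_sum)
    qed
    have row_transform: "(\<Sum>i<n. \<Sum>j=1..n. complex_of_real (a i j) * w ^ (k * i)) =
        (\<Sum>i<n. complex_of_real (R i) * w ^ (k * i))" for k
      by (intro sum.cong refl row) simp
    have col: "(\<Sum>i<n. \<Sum>j | j \<in> {1..n} \<and> j dvd k. a i j) = (\<Sum>j | j dvd n \<and> j dvd k. C j)" for k
    proof -
      have "(\<Sum>i<n. \<Sum>j | j \<in> {1..n} \<and> j dvd k. a i j) = (\<Sum>j | j \<in> {1..n} \<and> j dvd k. C j)"
        unfolding C_def by (rule sum.swap)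
      also have "\<dots> = (\<Sum>j | j dvd n \<and> j dvd k. C j)"
        unfolding C_def using sub \<open>?cols\<close> by (intro sum.mono_neutral_right) auto
      finally show ?thesis .
    qed
    have "?csp \<longleftrightarrow> (\<forall>k\<in>{1..n}. (\<Sum>i<n. complex_of_real (R i) * w ^ (k * i)) =
                              (\<Sum>i<n. complex_of_real (T i) * w ^ (k * i)))"
      by (simp only: T_transform col row_transform)
    also have "\<dots> \<longleftrightarrow> (\<forall>k\<in>{1..n}. (\<Sum>i<n. complex_of_real (R i - T i) * w ^ (k * i)) = 0)"
      by (simp add: left_diff_distrib sum_subtractf)
    also have "\<dots> \<longleftrightarrow> (\<forall>k<n. R k = T k)"
    proof
      assume zero: "\<forall>k\<in>{1..n}. (\<Sum>i<n. complex_of_real (R i - T i) * w ^ (k * i)) = 0"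
      have "complex_of_real (R k - T k) = 0" if "k < n" for k
        by (rule transform_eq_0_imp_eq_0[OF n w _ that]) (use zero in blast)
      then show "\<forall>k<n. R k = T k"
        by (simp flip: of_real_diff)
    qed simp
    finally show ?thesis .
  qed
  have "(\<forall>k<n. R k = T k) \<longleftrightarrow> (\<forall>k\<in>{1..<n}. R k = T k)"
  proof
    assume rows: "\<forall>k\<in>{1..<n}. R k = T k"
    have split: "(\<Sum>i<n. f i) = f 0 + (\<Sum>i=1..<n. f i)" for f :: "nat \<Rightarrow> real"
      using n by (simp add: sum.atLeast_Suc_lessThan lessThan_atLeast0)
    have "R 0 = T 0"
      using R_total T_total rows split[of R] split[of T] by simp
    with rows show "\<forall>k<n. R k = T k"
      by (metis One_nat_def Suc_leI atLeastLessThan_iff gr0I)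
  qed auto
  then show ?thesis
    using cols csp_iff unfolding R_def C_def T_def by blast
qed

section \<open>The linear forms\<close>

text \<open>
  The coefficient of \<open>x\<^bsub>ij\<^esub>\<close> is the comb value \<open>[n/c\<^sub>j divides k] n/c\<^sub>j\<close>, diminished by \<open>n\<close> on
  the diagonal \<open>i = k\<close>. Under \<open>b i j = n x\<^bsub>ij\<^esub>\<close> the first part collects column sums of \<open>b\<close> and the
  second the entries of row \<open>k\<close>.
\<close>

lemma H_form_eq_row_defect:
  fixes x b :: "nat \<Rightarrow> nat \<Rightarrow> real"
  assumes k: "k < n"
    and c: "\<And>j. j \<in> {2..d} \<Longrightarrow> c j dvd n"
    and b: "\<And>i j. i < n \<Longrightarrow> j \<in> {2..d} \<Longrightarrow> b i (c j) = real n * x i j"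
  shows "H_form n d c k x =
    (\<Sum>j=2..d. (if n div c j dvd k then (\<Sum>i<n. b i (c j)) / c j else 0) - b k (c j))"
proof -
  have idx: "{0..n-1} = {..<n}"
    using k by auto
  have "(\<Sum>i<n. of_int (H_coeff n c i j k) * x i j) =
      (if n div c j dvd k then (\<Sum>i<n. b i (c j)) / c j else 0) - b k (c j)"
    if j: "j \<in> {2..d}" for j
  proof -
    let ?t = "if n div c j dvd k then real n / c j else 0"
    have "(\<Sum>i<n. of_int (H_coeff n c i j k) * x i j) =
        (\<Sum>i<n. ?t * x i j - (if i = k then real n * x i j else 0))"
      using c[OF j]
      by (intro sum.cong) (auto simp: H_coeff_def cong_0_iff real_of_nat_div algebra_simps)
    also have "\<dots> = ?t * (\<Sum>i<n. x i j) - real n * x k j"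
      using k by (simp add: sum_subtractf flip: sum_distrib_left)
    finally show ?thesis
      using k j by (simp add: b flip: sum_distrib_left)
  qed
  then show ?thesis
    unfolding H_form_def idx by (subst sum.swap) simp
qed

theorem theorem7p1:
  fixes n d :: nat and c :: "nat \<Rightarrow> nat" and w :: complex and A :: "real mat"
  assumes "n \<ge> 1"
    and "primitive_root_of_unity n w"
    and "A \<in> carrier_mat n n"
    and "strict_mono_on {1..d} c"
    and "c ` {1..d} = {m. m dvd n}"
  shows "csp_matrix n w A \<longleftrightarrow>
    (\<exists>x :: nat \<Rightarrow> nat \<Rightarrow> real.
       col A (1 - 1) = vec n (\<lambda>i. if i = 0 then x 0 1 else H_form n d c i x) \<and>
       (\<forall>j\<in>{2..d}. col A (c j - 1) = vec n (\<lambda>i. real n * x i j)) \<and>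
       (\<forall>m\<in>{2..n}. \<not> m dvd n \<longrightarrow> col A (m - 1) = 0\<^sub>v n) \<and>
       0 \<le> x 0 1 \<and>
       (\<forall>i\<in>{0..n-1}. \<forall>j\<in>{2..d}. 0 \<le> x i j) \<and>
       (\<forall>k\<in>{1..n-1}. 0 \<le> H_form n d c k x))"
    (is "_ \<longleftrightarrow> (\<exists>x. ?param x)")
proof -
  note n = assms(1) and w = assms(2) and A = assms(3)
  define a where "a i j = A $$ (i, j - 1)" for i j
  define nonneg where "nonneg \<longleftrightarrow> (\<forall>i<n. \<forall>j\<in>{1..n}. 0 \<le> a i j)"
  define cols where "cols \<longleftrightarrow> (\<forall>j\<in>{1..n}. \<not> j dvd n \<longrightarrow> (\<forall>i<n. a i j = 0))"
  define rows where "rows \<longleftrightarrow> (\<forall>k\<in>{1..<n}. (\<Sum>j | j dvd n. a k j) =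
             (\<Sum>j | j dvd n. if n div j dvd k then (\<Sum>i<n. a i j) / j else 0))"
  have csp: "csp_matrix n w A \<longleftrightarrow> nonneg \<and> cols \<and> rows"
  proof (cases nonneg)
    case True
    then have "\<And>i j. i < n \<Longrightarrow> j \<in> {1..n} \<Longrightarrow> 0 \<le> a i j"
      by (simp add: nonneg_def)
    from csp_condition_iff_row_sums[OF n w this] show ?thesis
      using A True unfolding csp_matrix_def nonneg_def cols_def rows_def a_def atLeast0LessThan
      by simp
  next
    case False
    then show ?thesis
      by (auto simp: csp_matrix_def nonneg_def a_def)
  qed
  have inj: "inj_on c {1..d}"
    using assms(4) by (rule strict_mono_on_imp_inj_on)
  have d: "d \<ge> 1"
  proof -
    have "n \<in> c ` {1..d}"
      using assms(5) by simp
    then show ?thesis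
      by auto
  qed
  have c_dvd: "c j dvd n" if "j \<in> {1..d}" for j
    using that assms(5) by blast
  have c1: "c 1 = 1"
  proof -
    have "1 \<in> c ` {1..d}"
      using assms(5) by simp
    then obtain j where j: "j \<in> {1..d}" "c j = 1"
      by force
    have "c 1 \<le> c j"
      using j d strict_mono_on_leD[OF assms(4), of 1 j] by simp
    moreover have "c 1 > 0"
      using c_dvd[of 1] d n by (auto intro: Nat.gr0I)
    ultimately show ?thesis
      using j by simp
  qed
  have sum_divisors: "(\<Sum>j | j dvd n. f j) = f 1 + (\<Sum>j=2..d. f (c j))" for f :: "nat \<Rightarrow> real"
  proof -
    have "(\<Sum>j | j dvd n. f j) = (\<Sum>j=1..d. f (c j))"
      unfolding assms(5)[symmetric] by (simp only: sum.reindex[OF inj] o_def)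
    also have "\<dots> = f 1 + (\<Sum>j=2..d. f (c j))"
      using d c1 by (simp add: sum.atLeast_Suc_atMost numeral_2_eq_2)
    finally show ?thesis .
  qed
  have c_range: "c j \<in> {1..n}" if "j \<in> {1..d}" for j
    using c_dvd[OF that] n by (auto dest: dvd_imp_le intro: Suc_leI Nat.gr0I)
  have col_eq: "col A (m - 1) = vec n f \<longleftrightarrow> (\<forall>i<n. a i m = f i)" if "m \<in> {1..n}" for m f
    using A that by (auto simp: a_def vec_eq_iff)
  have rows_iff: "rows \<longleftrightarrow> (\<forall>k\<in>{1..<n}. a k 1 = H_form n d c k x)"
    if ax: "\<And>i j. i < n \<Longrightarrow> j \<in> {2..d} \<Longrightarrow> a i (c j) = real n * x i j" for x
  proof -
    have "(\<Sum>j | j dvd n. a k j) = (\<Sum>j | j dvd n. if n div j dvd k then (\<Sum>i<n. a i j) / j else 0)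
      \<longleftrightarrow> a k 1 = H_form n d c k x" if k: "k \<in> {1..<n}" for k
    proof -
      \<comment> \<open>So the sum of column \<open>1\<close> enters the right-hand side in row \<open>0\<close> only.\<close>
      have "\<not> n div 1 dvd k"
        using k by (auto dest: dvd_imp_le)
      moreover have "H_form n d c k x =
          (\<Sum>j=2..d. (if n div c j dvd k then (\<Sum>i<n. a i (c j)) / c j else 0) - a k (c j))"
        by (rule H_form_eq_row_defect) (use k c_dvd ax in auto)
      ultimately show ?thesis
        by (simp only: sum_divisors sum_subtractf) auto
    qed
    then show ?thesis
      by (simp add: rows_def)
  qed
  have param_iff: "?param x \<longleftrightarrow>
      (\<forall>i<n. a i 1 = (if i = 0 then x 0 1 else H_form n d c i x)) \<and>
      (\<forall>j\<in>{2..d}. \<forall>i<n. a i (c j) = real n * x i j) \<and> cols \<and>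
      0 \<le> x 0 1 \<and> (\<forall>i<n. \<forall>j\<in>{2..d}. 0 \<le> x i j) \<and> (\<forall>k\<in>{1..<n}. 0 \<le> H_form n d c k x)" for x
  proof -
    have idx: "{0..n-1} = {..<n}" "{1..n-1} = {1..<n}"
      using n by auto
    have ball_less: "(\<forall>i\<in>{..<n}. P i) \<longleftrightarrow> (\<forall>i<n. P i)" for P
      by auto
    have "cols \<longleftrightarrow> (\<forall>m\<in>{2..n}. \<not> m dvd n \<longrightarrow> (\<forall>i<n. a i m = 0))"
    proof -
      have "m \<in> {2..n}" if "m \<in> {1..n}" "\<not> m dvd n" for m
        using that by (cases "m = 1") auto
      moreover have "m \<in> {1..n}" if "m \<in> {2..n}" for m
        using that by simp
      ultimately show ?thesis
        unfolding cols_def by blast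
    qed
    moreover have "col A (1 - 1) = vec n (\<lambda>i. if i = 0 then x 0 1 else H_form n d c i x) \<longleftrightarrow>
        (\<forall>i<n. a i 1 = (if i = 0 then x 0 1 else H_form n d c i x))"
      using n by (intro col_eq) simp
    moreover have "col A (c j - 1) = vec n (\<lambda>i. real n * x i j) \<longleftrightarrow>
        (\<forall>i<n. a i (c j) = real n * x i j)" if "j \<in> {2..d}" for j
      using that by (intro col_eq c_range) simp
    moreover have "col A (m - 1) = 0\<^sub>v n \<longleftrightarrow> (\<forall>i<n. a i m = 0)" if "m \<in> {2..n}" for m
      unfolding zero_vec_def using that by (intro col_eq) simp
    ultimately show ?thesis
      unfolding idx ball_less by simp
  qed
  show ?thesis
  proof
    assume "csp_matrix n w A"
    then have nonneg cols rows
      using csp by auto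
    \<comment> \<open>For \<open>j = 1\<close> only \<open>i = 0\<close> is a parameter; the other values are arbitrary.\<close>
    define x where "x i j = (if j = 1 then a i 1 else a i (c j) / n)" for i j
    have ax: "a i (c j) = real n * x i j" if "i < n" "j \<in> {2..d}" for i j
      using n that by (simp add: x_def)
    have first: "\<forall>k\<in>{1..<n}. a k 1 = H_form n d c k x"
      using rows_iff[OF ax] \<open>rows\<close> by simp
    have pos: "0 \<le> a i j" if "i < n" "j \<in> {1..n}" for i j
      using \<open>nonneg\<close> that by (simp add: nonneg_def)
    have first': "a i 1 = (if i = 0 then x 0 1 else H_form n d c i x)" if "i < n" for i
      using first that by (cases "i = 0") (auto simp: x_def)
    have x01: "0 \<le> x 0 1"
      using pos[of 0 1] n by (simp add: x_def)
    have x: "0 \<le> x i j" if "i < n" "j \<in> {2..d}" for i j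
      using pos[of i "c j"] c_range[of j] that by (simp add: x_def)
    have H: "0 \<le> H_form n d c k x" if "k \<in> {1..<n}" for k
      using pos[of k 1] first that by simp
    have "?param x"
      unfolding param_iff[of x]
      by (intro conjI allI ballI impI first' ax \<open>cols\<close> x01 x H)
    then show "\<exists>x. ?param x"
      by (rule exI[where x = x])
  next
    assume "\<exists>x. ?param x"
    then obtain x where "?param x"
      by (rule exE)
    then have first: "\<And>i. i < n \<Longrightarrow> a i 1 = (if i = 0 then x 0 1 else H_form n d c i x)"
      and ax: "\<And>i j. i < n \<Longrightarrow> j \<in> {2..d} \<Longrightarrow> a i (c j) = real n * x i j"
      and cols
      and x01: "0 \<le> x 0 1"
      and x: "\<And>i j. i < n \<Longrightarrow> j \<in> {2..d} \<Longrightarrow> 0 \<le> x i j"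
      and H: "\<And>k. k \<in> {1..<n} \<Longrightarrow> 0 \<le> H_form n d c k x"
      unfolding param_iff[of x] by simp_all
    have "\<forall>k\<in>{1..<n}. a k 1 = H_form n d c k x"
      using first by simp
    then have rows
      using rows_iff[OF ax] by blast
    moreover have "0 \<le> a i m" if i: "i < n" and m: "m \<in> {1..n}" for i m
    proof (cases "m dvd n")
      case True
      then obtain j where j: "j \<in> {1..d}" "m = c j"
        using assms(5) by blast
      show ?thesis
      proof (cases "j = 1")
        case True
        then show ?thesis
          using first[OF i] x01 H[of i] i j c1 by (cases "i = 0") auto
      next
        case False
        then show ?thesis
          using ax[OF i, of j] x[OF i, of j] j by simp
      qed
    next
      case False
      then show ?thesis
        using \<open>cols\<close> i m by (simp add: cols_def)
    qed
    then have nonneg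
      by (simp add: nonneg_def)
    ultimately show "csp_matrix n w A"
      using csp \<open>cols\<close> by simp
  qed
qed

end
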